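(* Let $Y$ be a normed space, $y_0 = 0$, let $w \in Y$, and let $$F_{\lambda}(x, \varepsilon) = f(x) + \varepsilon^{-1} d(0, \Phi(x) - \varepsilon w)^2 + \lambda \varepsilon \quad \forall \varepsilon > 0,$$ where $d(0, \Phi(x) - \varepsilon w) = +\infty$ if $\Phi(x) = \emptyset$. Then the penalty function $F_{\lambda}(x,\varepsilon)$ is globally exact if and only if the penalty function $G_{\sigma}(x) = f(x) + \sigma d(0, \Phi(x))$ is globally exact, and (in this case) $$\frac{(\sigma^* )^2}{4} - \| w \| \sigma^* \le \lambda^* \le \left( \frac{\sigma^*}{2} + \| w \| \right)^2,$$ where $\lambda^*$ and $\sigma^*$ are the (global) exact penalty parameters of $F_\lambda$ and $G_{\sigma}$, respectively.
   Context: Setting: $X$ is a topological space, $f \colon X \to \mathbb{R} \cup \{+\infty\}$, $\Phi \colon X \rightrightarrows Y$ is a set-valued mapping with closed values, $A \subset X$ is nonempty. Problem $(\mathcal{P})$ (with $y_0=0$): minimize $f(x)$ subject to $0 \in \Phi(x)$, $x \in A$. The feasible set is $\Omega = \{x \in A \mid 0 \in \Phi(x)\}$; $\operatorname{dom} f = \{x \in X \mid f(x) < +\infty\}$. It is assumed that $\Omega \cap \operatorname{dom} f \neq \emptyset$ and $f$ is bounded below on $\Omega$. Here $d(0,\Phi(x)-\varepsilon w) = \inf_{z \in \Phi(x)} \|z - \varepsilon w\|$ and $d(0,\Phi(x)) = \inf_{z\in\Phi(x)}\|z\|$ (both $+\infty$ if $\Phi(x)=\emptyset$). $\mathbb{R}_+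 = [0,+\infty)$. Convention at $\varepsilon = 0$: $F_\lambda(x,0) = f(x)$ if $x$ is feasible, and $F_\lambda(x,0) = +\infty$ otherwise. Global exactness of a function of $(x,\varepsilon)$: $F_\lambda$ is globally exact if there exists $\lambda \ge 0$ such that $F_\lambda$ attains a global minimum on $A \times \mathbb{R}_+$ and every point $(x^*,\varepsilon^* )$ of global minimum of $F_\lambda$ on $A\times\mathbb{R}_+$ satisfies $\varepsilon^* = 0$; the greatest lower bound $\lambda^*$ of all such $\lambda\ge 0$ is the exact penalty parameter of $F_\lambda$. Global exactness of a function of $x$ only: $G_\sigma$ is globally exact if there exists $\sigma \ge 0$ such that $G_\sigma$ attains a global minimum on $A$ and every point of global minimum of $G_\sigma$ on $A$ belongs to $\Omega$; the greatest lower bound $\sigma^*$ of all such $\sigma \ge 0$ is its exact penalty parameter. *)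

theory Defs
  imports "HOL-Analysis.Analysis"
begin

(* The library's infdist is real-valued with infdist y {} = 0.  Here the infimum is taken in
   ereal, so that the distance to the empty set is +infinity. *)
definition ext_dist :: "'y::metric_space \<Rightarrow> 'y set \<Rightarrow> ereal" where
  "ext_dist y S = (INF z\<in>S. ereal (dist y z))"

definition eff_dom :: "('x \<Rightarrow> ereal) \<Rightarrow> 'x set" where
  "eff_dom f = {x. f x < \<infinity>}"

definition feasible :: "('x \<Rightarrow> 'y::real_normed_vector set) \<Rightarrow> 'x set \<Rightarrow> 'x set" where
  "feasible \<Phi> A = {x \<in> A. 0 \<in> \<Phi> x}"

(* F_lambda (x, eps); it is only ever considered for x in A and eps >= 0. *)
definition singular_penalty ::
  "('x \<Rightarrow> ereal) \<Rightarrow> ('x \<Rightarrow> 'y::real_normed_vector set) \<Rightarrow> 'x set \<Rightarrow> 'y \<Rightarrow>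
   real \<Rightarrow> 'x \<times> real \<Rightarrow> ereal" where
  "singular_penalty f \<Phi> A w lam = (\<lambda>(x, \<epsilon>).
     if \<epsilon> = 0 then (if x \<in> feasible \<Phi> A then f x else \<infinity>)
     else f x + ereal (inverse \<epsilon>) * (ext_dist 0 ((\<lambda>z. z - \<epsilon> *\<^sub>R w) ` \<Phi> x))\<^sup>2 + ereal (lam * \<epsilon>))"

(* G_sigma (x).  In ereal 0 * infinity = 0, so G_0 = f; the value chosen for 0 * infinity
   concerns sigma = 0 only and affects neither global exactness nor the exact penalty
   parameter. *)
definition linear_penalty ::
  "('x \<Rightarrow> ereal) \<Rightarrow> ('x \<Rightarrow> 'y::real_normed_vector set) \<Rightarrow> real \<Rightarrow> 'x \<Rightarrow> ereal" where
  "linear_penalty f \<Phi> \<sigma> x = f x + ereal \<sigma> * ext_dist 0 (\<Phi> x)"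

(* P c is the penalty function with parameter c, minimised over S; T is the set to which the
   global minimisers are required to belong.  For F_lambda, S = A \<times> {0..} and
   T = UNIV \<times> {0}; for G_sigma, S = A and T is the feasible set. *)
definition exact_params :: "(real \<Rightarrow> 'z \<Rightarrow> ereal) \<Rightarrow> 'z set \<Rightarrow> 'z set \<Rightarrow> real set" where
  "exact_params P S T =
     {c. 0 \<le> c \<and> (\<exists>z. is_arg_min (P c) (\<lambda>z. z \<in> S) z) \<and>
         (\<forall>z. is_arg_min (P c) (\<lambda>z. z \<in> S) z \<longrightarrow> z \<in> T)}"

definition globally_exact :: "(real \<Rightarrow> 'z \<Rightarrow> ereal) \<Rightarrow> 'z set \<Rightarrow> 'z set \<Rightarrow> bool" where
  "globally_exact P S T \<longleftrightarrow> (\<exists>c. c \<in> exact_params P S T)"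

(* Real infimum, meaningful only if globally_exact P S T holds. *)
definition exact_penalty_param :: "(real \<Rightarrow> 'z \<Rightarrow> ereal) \<Rightarrow> 'z set \<Rightarrow> 'z set \<Rightarrow> real" where
  "exact_penalty_param P S T = Inf (exact_params P S T)"

definition F_globally_exact ::
  "('x \<Rightarrow> ereal) \<Rightarrow> ('x \<Rightarrow> 'y::real_normed_vector set) \<Rightarrow> 'x set \<Rightarrow> 'y \<Rightarrow> bool" where
  "F_globally_exact f \<Phi> A w \<longleftrightarrow>
     globally_exact (singular_penalty f \<Phi> A w) (A \<times> {0..}) (UNIV \<times> {0})"

definition F_exact_param ::
  "('x \<Rightarrow> ereal) \<Rightarrow> ('x \<Rightarrow> 'y::real_normed_vector set) \<Rightarrow> 'x set \<Rightarrow> 'y \<Rightarrow> real" where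
  "F_exact_param f \<Phi> A w =
     exact_penalty_param (singular_penalty f \<Phi> A w) (A \<times> {0..}) (UNIV \<times> {0})"

definition G_globally_exact ::
  "('x \<Rightarrow> ereal) \<Rightarrow> ('x \<Rightarrow> 'y::real_normed_vector set) \<Rightarrow> 'x set \<Rightarrow> bool" where
  "G_globally_exact f \<Phi> A \<longleftrightarrow> globally_exact (linear_penalty f \<Phi>) A (feasible \<Phi> A)"

definition G_exact_param ::
  "('x \<Rightarrow> ereal) \<Rightarrow> ('x \<Rightarrow> 'y::real_normed_vector set) \<Rightarrow> 'x set \<Rightarrow> real" where
  "G_exact_param f \<Phi> A = exact_penalty_param (linear_penalty f \<Phi>) A (feasible \<Phi> A)"

end

theory Submission
  imports Defs
begin

text \<open>
  Write \<open>d x\<close> for the distance from \<open>0\<close> to \<open>\<Phi> x\<close> and \<open>D x\<close> for the distance from \<open>\<epsilon> w\<close> to \<open>\<Phi> x\<close>,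
  which is the distance that occurs in the singular penalty.  They differ by at most
  \<open>\<epsilon> * norm w\<close>, so the theorem is a comparison, up to this error, of \<open>\<sigma> d\<close> with
  \<open>d\<^sup>2 / \<epsilon> + \<lambda> \<epsilon>\<close>.  Minimising the latter over \<open>\<epsilon> > 0\<close> gives \<open>2 sqrt \<lambda> d\<close>; this is the source of the
  relation \<open>\<sigma> \<approx> 2 sqrt \<lambda>\<close> between the parameters.

  Exactness asks that the minimisers all lie in a prescribed set, which is awkward to carry from
  one penalty function to the other.  It is therefore replaced by the nonstrict requirement that
  some value \<open>v\<close> that \<open>f\<close> attains at a feasible point bounds the penalty function from below.
  An exact parameter satisfies this (\<open>exact_param_imp_bound\<close>), and, since infeasibility is penalised strictly
  more when the parameter grows, every parameter strictly above one with such a bound is exact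
  (\<open>exact_params_above_bound\<close>).  The two requirements define parameter sets with the same infimum.

  The lower bound \<open>v\<close> is transferred in both directions by elementary inequalities.
  From \<open>G\<^sub>\<sigma>\<close> to \<open>F\<^sub>\<lambda>\<close>, it suffices that \<open>\<lambda> \<ge> \<sigma>\<^sup>2 / 4 + norm w * \<sigma>\<close>, which is at most
  \<open>(\<sigma> / 2 + norm w)\<^sup>2\<close> (\<open>singular_bound_from_linear_bound\<close>).  From \<open>F\<^sub>\<lambda>\<close> to \<open>G\<^sub>\<sigma>\<close>, evaluating at the
  \<open>\<epsilon>\<close> proportional to \<open>d x\<close> shows that \<open>\<sigma> = 2 (s + norm w)\<close> suffices as soon as \<open>s > 0\<close> and
  \<open>s\<^sup>2 \<ge> \<lambda> + (norm w)\<^sup>2\<close> (\<open>linear_bound_from_singular_bound\<close>).  Solving for \<open>\<lambda>\<close> at \<open>s = sqrt (\<lambda> + (norm w)\<^sup>2)\<close> turns this into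
  \<open>\<sigma>\<^sup>2 / 4 - norm w * \<sigma> \<le> \<lambda>\<close>.
\<close>

section \<open>Penalty functions that penalise strictly outside a set\<close>

text \<open>
  The common features of the two penalty functions: the parameter does not matter on \<open>T\<close>, and
  outside \<open>T\<close> increasing it turns a lower bound by a real number into a strict one.  The latter
  is a form of strict monotonicity that tolerates the value \<open>\<infinity>\<close>.
\<close>

locale strict_penalty =
  fixes P :: "real \<Rightarrow> 'z \<Rightarrow> ereal" and S T :: "'z set"
  assumes on_T: "\<And>z c c'. z \<in> S \<Longrightarrow> z \<in> T \<Longrightarrow> P c z = P c' z"
    and off_T: "\<And>z c c' v. z \<in> S \<Longrightarrow> z \<notin> T \<Longrightarrow> 0 \<le> c \<Longrightarrow> c < c' \<Longrightarrow>
      ereal v \<le> P c z \<Longrightarrow> ereal v < P c' z"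
    and proper: "\<exists>z\<in>S \<inter> T. \<forall>c. P c z < \<infinity>"
    and not_MInf: "\<And>z c. z \<in> S \<Longrightarrow> z \<in> T \<Longrightarrow> P c z \<noteq> -\<infinity>"
begin

lemma exact_param_imp_bound:
  assumes "c \<in> exact_params P S T"
  obtains z v where "z \<in> S" "z \<in> T" "\<forall>c'. P c' z = ereal v" "\<forall>y\<in>S. ereal v \<le> P c y"
proof -
  from assms obtain z where z: "is_arg_min (P c) (\<lambda>z. z \<in> S) z" and "z \<in> T"
    unfolding exact_params_def by blast
  from z have "z \<in> S" and le: "\<And>y. y \<in> S \<Longrightarrow> P c z \<le> P c y"
    by (auto simp: is_arg_min_linorder)
  from proper obtain y where "y \<in> S" "P c y < \<infinity>" by blast
  with le[of y] have "P c z < \<infinity>" by auto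
  with not_MInf[OF \<open>z \<in> S\<close> \<open>z \<in> T\<close>, of c] obtain v where v: "P c z = ereal v"
    by (cases "P c z") auto
  show thesis
  proof (rule that[OF \<open>z \<in> S\<close> \<open>z \<in> T\<close>])
    show "\<forall>c'. P c' z = ereal v" using on_T[OF \<open>z \<in> S\<close> \<open>z \<in> T\<close>] v by metis
    show "\<forall>y\<in>S. ereal v \<le> P c y" using le v by simp
  qed
qed

lemma exact_params_above_bound:
  assumes z: "z \<in> S" "z \<in> T" "\<And>c'. P c' z = ereal v"
    and bound: "\<And>y. y \<in> S \<Longrightarrow> ereal v \<le> P c y"
    and "0 \<le> c" "c < c'"
  shows "c' \<in> exact_params P S T"
proof -
  have strict: "ereal v < P c' y" if "y \<in> S" "y \<notin> T" for y
    using off_T[OF that assms(5,6) bound] that by blast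
  have "ereal v \<le> P c' y" if "y \<in> S" for y
    using bound[OF that] strict[OF that] on_T[OF that] by (metis order_less_imp_le)
  then have "is_arg_min (P c') (\<lambda>z. z \<in> S) z"
    using z by (simp add: is_arg_min_linorder)
  moreover have "y \<in> T" if "is_arg_min (P c') (\<lambda>z. z \<in> S) y" for y
    using that z strict[of y] by (force simp: is_arg_min_def)
  ultimately show ?thesis using assms(5,6) unfolding exact_params_def by auto
qed

end

lemma exact_penalty_param_le:
  assumes "\<And>c'. c < c' \<Longrightarrow> c' \<in> exact_params P S T"
  shows "exact_penalty_param P S T \<le> c"
proof (rule dense_ge)
  fix c' assume "c < c'"
  have "bdd_below (exact_params P S T)"
    by (rule bdd_belowI[of _ 0]) (simp add: exact_params_def)
  then show "exact_penalty_param P S T \<le> c'"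
    unfolding exact_penalty_param_def using assms[OF \<open>c < c'\<close>] by (rule cInf_lower[rotated])
qed

section \<open>The two penalty functions\<close>

lemma ext_dist_eq_infdist:
  "ext_dist y S = (if S = {} then \<infinity> else ereal (infdist y S))"
proof (cases "S = {}")
  case False
  have "bdd_below (dist y ` S)" by (rule bdd_belowI[of _ 0]) auto
  then have "ereal (Inf (dist y ` S)) = (INF z\<in>S. ereal (dist y z))"
    using False by (subst ereal_Inf') (auto simp: image_image)
  with False show ?thesis by (simp add: ext_dist_def infdist_def)
qed (simp add: ext_dist_def top_ereal_def)

lemma ext_dist_translate:
  fixes u :: "'y::real_normed_vector"
  shows "ext_dist 0 ((\<lambda>z. z - u) ` S) = ext_dist u S"
  by (simp add: ext_dist_def image_image dist_norm norm_minus_commute)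

lemma singular_penalty_pos:
  assumes "0 < \<epsilon>"
  shows "singular_penalty f \<Phi> A w lam (x, \<epsilon>) = (if \<Phi> x = {} \<or> f x = \<infinity> then \<infinity>
    else f x + ereal ((infdist (\<epsilon> *\<^sub>R w) (\<Phi> x))\<^sup>2 / \<epsilon> + lam * \<epsilon>))"
  unfolding singular_penalty_def ext_dist_translate using assms
  by (cases "f x") (auto simp: ext_dist_eq_infdist power2_eq_square field_simps)

lemma linear_penalty_nonempty:
  assumes "\<Phi> x \<noteq> {}"
  shows "linear_penalty f \<Phi> \<sigma> x = f x + ereal (\<sigma> * infdist 0 (\<Phi> x))"
  using assms by (simp add: linear_penalty_def ext_dist_eq_infdist)

lemma linear_penalty_feasible:
  assumes "0 \<in> \<Phi> x"
  shows "linear_penalty f \<Phi> \<sigma> x = f x"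
proof -
  have "\<Phi> x \<noteq> {}" using assms by auto
  with assms show ?thesis by (simp add: linear_penalty_nonempty flip: zero_ereal_def)
qed

lemma strict_penalty_linear:
  assumes f: "\<And>x. f x \<noteq> -\<infinity>"
    and closed: "\<And>x. closed (\<Phi> x)"
    and dom: "feasible \<Phi> A \<inter> eff_dom f \<noteq> {}"
  shows "strict_penalty (linear_penalty f \<Phi>) A (feasible \<Phi> A)"
proof
  fix x and \<sigma> \<sigma>' v :: real
  assume x: "x \<in> A" "x \<notin> feasible \<Phi> A" and \<sigma>: "0 \<le> \<sigma>" "\<sigma> < \<sigma>'"
    and v: "ereal v \<le> linear_penalty f \<Phi> \<sigma> x"
  show "ereal v < linear_penalty f \<Phi> \<sigma>' x"
  proof (cases "\<Phi> x = {}")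
    case True
    with \<sigma> f[of x] show ?thesis by (simp add: linear_penalty_def ext_dist_eq_infdist)
  next
    case False
    have "infdist 0 (\<Phi> x) \<noteq> 0"
      using x closed[of x] False by (auto simp: feasible_def in_closed_iff_infdist_zero)
    then have "\<sigma> * infdist 0 (\<Phi> x) < \<sigma>' * infdist 0 (\<Phi> x)"
      using \<sigma> infdist_nonneg[of 0 "\<Phi> x"] by simp
    with v f[of x] show ?thesis
      by (cases "f x") (auto simp: linear_penalty_nonempty[of \<Phi>, OF False])
  qed
qed (use f dom in \<open>auto simp: feasible_def linear_penalty_feasible eff_dom_def\<close>)

lemma strict_penalty_singular:
  assumes f: "\<And>x. f x \<noteq> -\<infinity>"
    and dom: "feasible \<Phi> A \<inter> eff_dom f \<noteq> {}"
  shows "strict_penalty (singular_penalty f \<Phi> A w) (A \<times> {0..}) (UNIV \<times> {0})"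
proof
  fix z and lam lam' v :: real
  assume "z \<in> A \<times> {0..}" "z \<notin> UNIV \<times> {0}" and lam: "0 \<le> lam" "lam < lam'"
    and v: "ereal v \<le> singular_penalty f \<Phi> A w lam z"
  then obtain x \<epsilon> where z: "z = (x, \<epsilon>)" and \<epsilon>: "0 < \<epsilon>"
    by (cases z) force
  have "lam * \<epsilon> < lam' * \<epsilon>" using \<epsilon> lam by simp
  with v f[of x] show "ereal v < singular_penalty f \<Phi> A w lam' z"
    unfolding z singular_penalty_pos[OF \<epsilon>] by (cases "f x") (auto split: if_splits)
next
  from dom obtain x where "x \<in> feasible \<Phi> A" "f x < \<infinity>" by (auto simp: eff_dom_def)
  then show "\<exists>z\<in>A \<times> {0..} \<inter> UNIV \<times> {0}. \<forall>lam. singular_penalty f \<Phi> A w lam z < \<infinity>"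
    by (intro bexI[of _ "(x, 0)"]) (auto simp: singular_penalty_def feasible_def)
qed (use f in \<open>auto simp: singular_penalty_def split: if_splits\<close>)

section \<open>Transferring a lower bound\<close>

text \<open>
  Both transfer lemmas compare the distances from \<open>0\<close> and from \<open>\<epsilon> w\<close> by the triangle
  inequality.  Here \<open>(D - \<sigma> \<epsilon> / 2)\<^sup>2 \<ge> 0\<close> bounds \<open>D\<^sup>2 / \<epsilon>\<close> from below by \<open>\<sigma> D - \<sigma>\<^sup>2 \<epsilon> / 4\<close>, and replacing
  \<open>D\<close> by \<open>d\<close> costs \<open>\<sigma> * norm w * \<epsilon>\<close>; both losses are linear in \<open>\<epsilon>\<close> and absorbed by \<open>lam \<epsilon>\<close>.
\<close>

lemma singular_bound_from_linear_bound:
  assumes "0 \<le> \<sigma>" and lam: "\<sigma>\<^sup>2 / 4 + norm w * \<sigma> \<le> lam" and f: "\<And>x. f x \<noteq> -\<infinity>"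
    and bound: "\<And>x. x \<in> A \<Longrightarrow> ereal v \<le> linear_penalty f \<Phi> \<sigma> x"
    and z: "z \<in> A \<times> {0..}"
  shows "ereal v \<le> singular_penalty f \<Phi> A w lam z"
proof -
  obtain x \<epsilon> where [simp]: "z = (x, \<epsilon>)" by (cases z)
  have "x \<in> A" "0 \<le> \<epsilon>" using z by auto
  show ?thesis
  proof (cases "\<epsilon> = 0")
    case True
    then show ?thesis using bound[OF \<open>x \<in> A\<close>]
      by (auto simp: singular_penalty_def feasible_def linear_penalty_feasible)
  next
    case False
    with \<open>0 \<le> \<epsilon>\<close> have "0 < \<epsilon>" by simp
    let ?d = "infdist 0 (\<Phi> x)" and ?D = "infdist (\<epsilon> *\<^sub>R w) (\<Phi> x)"
    show ?thesis
    proof (cases "\<Phi> x = {} \<or> f x = \<infinity>")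
      case True
      then show ?thesis using singular_penalty_pos[OF \<open>0 < \<epsilon>\<close>, of f \<Phi> A w lam x] by simp
    next
      case ne: False
      have "?d \<le> ?D + \<epsilon> * norm w"
        using infdist_triangle[of 0 "\<Phi> x" "\<epsilon> *\<^sub>R w"] \<open>0 < \<epsilon>\<close> by simp
      then have "\<sigma> * ?d \<le> \<sigma> * (?D + \<epsilon> * norm w)"
        using \<open>0 \<le> \<sigma>\<close> by (rule mult_left_mono)
      also have "\<dots> \<le> ?D\<^sup>2 / \<epsilon> + (\<sigma>\<^sup>2 / 4 + norm w * \<sigma>) * \<epsilon>"
      proof -
        have "0 \<le> (?D - \<sigma> * \<epsilon> / 2)\<^sup>2 / \<epsilon>" using \<open>0 < \<epsilon>\<close> by simp
        also have "\<dots> = ?D\<^sup>2 / \<epsilon> + \<sigma>\<^sup>2 / 4 * \<epsilon> - \<sigma> * ?D"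
          using \<open>0 < \<epsilon>\<close> by (simp add: field_simps power2_eq_square)
        finally show ?thesis by (simp add: algebra_simps)
      qed
      also have "\<dots> \<le> ?D\<^sup>2 / \<epsilon> + lam * \<epsilon>"
        using lam \<open>0 < \<epsilon>\<close> by simp
      finally have "\<sigma> * ?d \<le> ?D\<^sup>2 / \<epsilon> + lam * \<epsilon>" .
      then show ?thesis
        using bound[OF \<open>x \<in> A\<close>] ne f[of x] singular_penalty_pos[OF \<open>0 < \<epsilon>\<close>, of f \<Phi> A w lam x]
        by (cases "f x") (auto simp: linear_penalty_nonempty[of \<Phi>])
    qed
  qed
qed

text \<open>
  With \<open>D \<le> d + \<epsilon> * norm w\<close>, the term added to \<open>f\<close> is at most
  \<open>d\<^sup>2 / \<epsilon> + 2 * norm w * d + (lam + (norm w)\<^sup>2) * \<epsilon>\<close>, which is smallest at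
  \<open>\<epsilon> = d / sqrt (lam + (norm w)\<^sup>2)\<close>.  The root is replaced by an arbitrary positive majorant \<open>s\<close>
  because it vanishes if \<open>lam = 0\<close> and \<open>w = 0\<close>.
\<close>

lemma linear_bound_from_singular_bound:
  assumes "0 < s" and s: "lam + (norm w)\<^sup>2 \<le> s\<^sup>2"
    and f: "\<And>x. f x \<noteq> -\<infinity>" and closed: "\<And>x. closed (\<Phi> x)"
    and bound: "\<And>z. z \<in> A \<times> {0..} \<Longrightarrow> ereal v \<le> singular_penalty f \<Phi> A w lam z"
    and x: "x \<in> A"
  shows "ereal v \<le> linear_penalty f \<Phi> (2 * (s + norm w)) x"
proof (cases "\<Phi> x = {}")
  case True
  moreover have "0 < 2 * (s + norm w)"
    using \<open>0 < s\<close> by (simp add: add_pos_nonneg)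
  ultimately show ?thesis by (simp add: linear_penalty_def ext_dist_eq_infdist)
next
  case ne: False
  define d where "d = infdist 0 (\<Phi> x)"
  show ?thesis
  proof (cases "0 \<in> \<Phi> x")
    case True
    then have "singular_penalty f \<Phi> A w lam (x, 0) = f x"
      using x by (simp add: singular_penalty_def feasible_def)
    then show ?thesis
      using bound[of "(x, 0)"] x True by (simp add: linear_penalty_feasible)
  next
    case False
    then have "d \<noteq> 0"
      using closed[of x] ne by (auto simp: d_def in_closed_iff_infdist_zero)
    then have "0 < d" using infdist_nonneg[of 0 "\<Phi> x"] by (simp add: d_def)
    define \<epsilon> where "\<epsilon> = d / s"
    have "0 < \<epsilon>" using \<open>0 < d\<close> \<open>0 < s\<close> by (simp add: \<epsilon>_def)
    let ?D = "infdist (\<epsilon> *\<^sub>R w) (\<Phi> x)"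
    have "?D \<le> d + \<epsilon> * norm w"
      using infdist_triangle[of "\<epsilon> *\<^sub>R w" "\<Phi> x" 0] \<open>0 < \<epsilon>\<close> by (simp add: d_def)
    then have "?D\<^sup>2 \<le> (d + \<epsilon> * norm w)\<^sup>2"
      by (intro power_mono infdist_nonneg)
    then have "?D\<^sup>2 / \<epsilon> + lam * \<epsilon> \<le> (d + \<epsilon> * norm w)\<^sup>2 / \<epsilon> + lam * \<epsilon>"
      using \<open>0 < \<epsilon>\<close> by (simp add: divide_right_mono)
    also have "\<dots> = d\<^sup>2 / \<epsilon> + 2 * norm w * d + (lam + (norm w)\<^sup>2) * \<epsilon>"
      using \<open>0 < \<epsilon>\<close> by (simp add: field_simps power2_eq_square)
    also have "\<dots> \<le> d\<^sup>2 / \<epsilon> + 2 * norm w * d + s\<^sup>2 * \<epsilon>"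
      using s \<open>0 < \<epsilon>\<close> by simp
    also have "\<dots> = 2 * (s + norm w) * d"
      using \<open>0 < d\<close> \<open>0 < s\<close> by (simp add: \<epsilon>_def field_simps power2_eq_square)
    finally have "?D\<^sup>2 / \<epsilon> + lam * \<epsilon> \<le> 2 * (s + norm w) * d" .
    moreover have "ereal v \<le> singular_penalty f \<Phi> A w lam (x, \<epsilon>)"
      using bound x \<open>0 < \<epsilon>\<close> by simp
    ultimately show ?thesis
      using ne f[of x] unfolding singular_penalty_pos[OF \<open>0 < \<epsilon>\<close>]
      by (cases "f x") (auto simp: linear_penalty_nonempty[of \<Phi>] d_def)
  qed
qed

section \<open>Comparison of the exact penalty parameters\<close>

lemma exact_singular_above_exact_linear:
  assumes f: "\<And>x. f x \<noteq> -\<infinity>" and closed: "\<And>x. closed (\<Phi> x)"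
    and dom: "feasible \<Phi> A \<inter> eff_dom f \<noteq> {}"
    and \<sigma>: "\<sigma> \<in> exact_params (linear_penalty f \<Phi>) A (feasible \<Phi> A)"
    and lam: "(\<sigma> / 2 + norm w)\<^sup>2 < lam"
  shows "lam \<in> exact_params (singular_penalty f \<Phi> A w) (A \<times> {0..}) (UNIV \<times> {0})"
proof -
  have "0 \<le> \<sigma>" using \<sigma> by (simp add: exact_params_def)
  obtain x v where x: "x \<in> A" "x \<in> feasible \<Phi> A" "\<forall>c. linear_penalty f \<Phi> c x = ereal v"
    and bound: "\<forall>y\<in>A. ereal v \<le> linear_penalty f \<Phi> \<sigma> y"
    by (rule strict_penalty.exact_param_imp_bound[OF strict_penalty_linear[OF f closed dom] \<sigma>])
  have "\<sigma>\<^sup>2 / 4 + norm w * \<sigma> \<le> (\<sigma> / 2 + norm w)\<^sup>2"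
    by (simp add: power2_eq_square algebra_simps)
  note lower = singular_bound_from_linear_bound[OF \<open>0 \<le> \<sigma>\<close> this f bound[rule_format]]
  have "singular_penalty f \<Phi> A w c (x, 0) = ereal v" for c
    using x by (simp add: singular_penalty_def feasible_def linear_penalty_feasible)
  then show ?thesis
    using x lam
    by (intro strict_penalty.exact_params_above_bound
          [OF strict_penalty_singular[OF f dom], where z = "(x, 0)", OF _ _ _ lower]) auto
qed

lemma exact_linear_above_exact_singular:
  assumes f: "\<And>x. f x \<noteq> -\<infinity>" and closed: "\<And>x. closed (\<Phi> x)"
    and dom: "feasible \<Phi> A \<inter> eff_dom f \<noteq> {}"
    and lam: "lam \<in> exact_params (singular_penalty f \<Phi> A w) (A \<times> {0..}) (UNIV \<times> {0})"
    and s: "0 < s" "lam + (norm w)\<^sup>2 \<le> s\<^sup>2" and \<sigma>: "2 * (s + norm w) < \<sigma>"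
  shows "\<sigma> \<in> exact_params (linear_penalty f \<Phi>) A (feasible \<Phi> A)"
proof -
  obtain z v where z: "z \<in> A \<times> {0..}" "z \<in> UNIV \<times> {0}"
      "\<forall>c. singular_penalty f \<Phi> A w c z = ereal v"
    and bound: "\<forall>y\<in>A \<times> {0..}. ereal v \<le> singular_penalty f \<Phi> A w lam y"
    by (rule strict_penalty.exact_param_imp_bound[OF strict_penalty_singular[OF f dom] lam])
  note lower = linear_bound_from_singular_bound[OF s f closed bound[rule_format]]
  obtain x where [simp]: "z = (x, 0)" using z(2) by (cases z) auto
  have x: "x \<in> feasible \<Phi> A" "f x = ereal v"
    using z(3)[rule_format, of 0] by (auto simp: singular_penalty_def split: if_splits)
  then show ?thesis
    using \<sigma> s(1)
    by (intro strict_penalty.exact_params_above_bound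
          [OF strict_penalty_linear[OF f closed dom], where z = x, OF _ _ _ lower])
       (auto simp: feasible_def linear_penalty_feasible)
qed

theorem theorem3:
  fixes f :: "'x::topological_space \<Rightarrow> ereal"
    and \<Phi> :: "'x \<Rightarrow> 'y::real_normed_vector set"
    and A :: "'x set"
    and w :: 'y
  assumes "\<And>x. f x \<noteq> -\<infinity>"
    and "\<And>x. closed (\<Phi> x)"
    and "A \<noteq> {}"
    and "feasible \<Phi> A \<inter> eff_dom f \<noteq> {}"
    and "\<exists>m::real. \<forall>x\<in>feasible \<Phi> A. ereal m \<le> f x"
  shows "(F_globally_exact f \<Phi> A w \<longleftrightarrow> G_globally_exact f \<Phi> A) \<and>
    (G_globally_exact f \<Phi> A \<longrightarrow>
      (G_exact_param f \<Phi> A)\<^sup>2 / 4 - norm w * G_exact_param f \<Phi> A \<le> F_exact_param f \<Phi> A w \<and>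
      F_exact_param f \<Phi> A w \<le> (G_exact_param f \<Phi> A / 2 + norm w)\<^sup>2)"
proof -
  let ?F = "exact_params (singular_penalty f \<Phi> A w) (A \<times> {0..}) (UNIV \<times> {0})"
  let ?G = "exact_params (linear_penalty f \<Phi>) A (feasible \<Phi> A)"
  let ?lam = "F_exact_param f \<Phi> A w" and ?\<sigma> = "G_exact_param f \<Phi> A"
  note toF = exact_singular_above_exact_linear[OF assms(1,2,4), where w = w]
    and toG = exact_linear_above_exact_singular[OF assms(1,2,4), where w = w]
  have lam_le: "?lam \<le> c" if "\<And>c'. c < c' \<Longrightarrow> c' \<in> ?F" for c
    unfolding F_exact_param_def using that by (rule exact_penalty_param_le)
  have \<sigma>_le: "?\<sigma> \<le> c" if "\<And>c'. c < c' \<Longrightarrow> c' \<in> ?G" for c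
    unfolding G_exact_param_def using that by (rule exact_penalty_param_le)
  have nonneg: "0 \<le> c" if "c \<in> ?F \<or> c \<in> ?G" for c
    using that by (auto simp: exact_params_def)
  have F_imp_G: "?G \<noteq> {}" if "lam \<in> ?F" for lam
  proof -
    (* s exceeds the root by 1 to be positive even if lam = 0 and w = 0; the second 1 makes the
       parameter strictly greater than 2 * (s + norm w). *)
    have "lam + (norm w)\<^sup>2 \<le> (sqrt (lam + (norm w)\<^sup>2) + 1)\<^sup>2"
      using nonneg[of lam] that by (simp add: power2_sum)
    moreover have "0 < sqrt (lam + (norm w)\<^sup>2) + 1"
      using nonneg[of lam] that by (intro add_nonneg_pos) auto
    ultimately have "2 * (sqrt (lam + (norm w)\<^sup>2) + 1 + norm w) + 1 \<in> ?G"
      using toG[OF that] by simp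
    then show ?thesis by blast
  qed
  have G_imp_F: "?F \<noteq> {}" if "\<sigma> \<in> ?G" for \<sigma>
    using toF[OF that] gt_ex by blast
  have iff: "F_globally_exact f \<Phi> A w \<longleftrightarrow> G_globally_exact f \<Phi> A"
    unfolding F_globally_exact_def G_globally_exact_def globally_exact_def
    using F_imp_G G_imp_F by blast
  have "?\<sigma>\<^sup>2 / 4 - norm w * ?\<sigma> \<le> ?lam \<and> ?lam \<le> (?\<sigma> / 2 + norm w)\<^sup>2"
    if "G_globally_exact f \<Phi> A"
  proof
    have G: "?G \<noteq> {}"
      using that by (auto simp: G_globally_exact_def globally_exact_def)
    then have F: "?F \<noteq> {}" using G_imp_F by blast
    have lam_Inf: "?lam = Inf ?F" and \<sigma>_Inf: "?\<sigma> = Inf ?G"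
      by (simp_all add: F_exact_param_def G_exact_param_def exact_penalty_param_def)
    have "0 \<le> ?lam" "0 \<le> ?\<sigma>"
      unfolding lam_Inf \<sigma>_Inf using F G nonneg by (auto intro: cInf_greatest)
    have "?\<sigma>\<^sup>2 / 4 - norm w * ?\<sigma> \<le> lam" if "lam \<in> ?F" for lam
    proof (rule ccontr)
      assume "\<not> ?thesis"
      then have lt: "lam < ?\<sigma>\<^sup>2 / 4 - norm w * ?\<sigma>" by simp
      then have sq: "lam + (norm w)\<^sup>2 < (?\<sigma> / 2 - norm w)\<^sup>2"
        by (simp add: power2_eq_square algebra_simps)
      (* The square root of (sigma / 2 - norm w)^2 has the right sign:
         lt gives sigma * (sigma / 4 - norm w) > 0. *)
      have "0 < ?\<sigma> * (?\<sigma> / 4 - norm w)"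
        using lt nonneg[of lam] that by (simp add: power2_eq_square algebra_simps)
      then have "0 < ?\<sigma> / 4 - norm w"
        using \<open>0 \<le> ?\<sigma>\<close> by (simp add: zero_less_mult_iff)
      then have "0 \<le> ?\<sigma> / 2 - norm w" using \<open>0 \<le> ?\<sigma>\<close> by simp
      with sq have "sqrt (lam + (norm w)\<^sup>2) < ?\<sigma> / 2 - norm w"
        by (metis real_sqrt_less_iff real_sqrt_unique)
      (* A majorant s below sigma / 2 - norm w makes 2 * (s + norm w), and hence the infimum of
         the exact parameters, smaller than sigma. *)
      then obtain s where s: "sqrt (lam + (norm w)\<^sup>2) < s" "s < ?\<sigma> / 2 - norm w"
        using dense by blast
      have ge: "0 \<le> lam + (norm w)\<^sup>2" using nonneg[of lam] that by simp
      then have "0 < s" using s(1) real_sqrt_ge_zero[OF ge] by linarith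
      moreover have "lam + (norm w)\<^sup>2 \<le> s\<^sup>2"
        using s(1) by (intro sqrt_le_D) simp
      ultimately have "?\<sigma> \<le> 2 * (s + norm w)"
        using toG[OF that] by (intro \<sigma>_le) blast
      with s(2) show False by simp
    qed
    then show "?\<sigma>\<^sup>2 / 4 - norm w * ?\<sigma> \<le> ?lam"
      unfolding lam_Inf using F by (intro cInf_greatest)
    show "?lam \<le> (?\<sigma> / 2 + norm w)\<^sup>2"
    proof (rule ccontr)
      assume "\<not> ?thesis"
      then have "sqrt ((?\<sigma> / 2 + norm w)\<^sup>2) < sqrt ?lam"
        by (simp only: real_sqrt_less_iff not_le)
      then have "Inf ?G < 2 * (sqrt ?lam - norm w)"
        using \<open>0 \<le> ?\<sigma>\<close> \<sigma>_Inf by simp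
      then obtain \<sigma> where \<sigma>: "\<sigma> \<in> ?G" "\<sigma> < 2 * (sqrt ?lam - norm w)"
        using cInf_lessD[OF G] by blast
      have "?lam \<le> (\<sigma> / 2 + norm w)\<^sup>2"
        using toF[OF \<sigma>(1)] by (intro lam_le)
      moreover have "(\<sigma> / 2 + norm w)\<^sup>2 < (sqrt ?lam)\<^sup>2"
        using \<sigma> nonneg[of \<sigma>] by (intro power_strict_mono) auto
      ultimately show False using \<open>0 \<le> ?lam\<close> by simp
    qed
  qed
  with iff show ?thesis by blast
qed

end
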